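(* Let $n,d\ge 1$ and $t\ge 0$ be integers with $n>3t$. For $n$ clients with vectors in $\mathbb{R}^d$, up to $t$ of which are Byzantine, consider the MDA algorithm, which outputs the average of a subset of $n-t$ received vectors having the smallest diameter, where the diameter of a subset is the maximum distance between any two of its vectors. The MDA algorithm computes a $2$-approximation of the centroid.
   Context: Model. There are $n$ clients, up to $t<n/3$ of which are Byzantine, and one trusted server. The server receives a family of $m$ vectors $(v_i)_{i\in M}$ in $\mathbb{R}^d$ (Euclidean norm and distance $\mathrm{dist}$), where $M\subseteq\{1,\dots,n\}$, $|M|=m$, $n-t\le m\le n$. An unknown set $N\subseteq M$ with $|N|\ge n-t$ is the set of non-faulty clients; the vectors of the clients in $M\setminus N$ are Byzantine and arbitrary. An aggregation algorithm is a deterministic function of the received family only (it does not know $N$); its output is a vector in $\mathbb{R}^d$. A received family together with an admissible set $N$ is called a configuration. In MDA, ties between subsets of smallest diameter are broken arbitrarily. True centroid: $\mathrm{Cent}^\star=\frac1{|N|}\sum_{i\in N}v_i$. Candidate centroids: $S_{\mathrm{Cent}}$ is the set of all averages $\frac{1}{n-t}\sum_{i\in I}v_i$ with $I\subseteq M$, $|I|=n-t$. Let $\mathrm{Rad_{cov}}$ be the radius of the smallest closed Euclidean ball containing $S_{\mathrm{Cent}}$. Approximation: an algorithm computes an $\alpha$-approximation of the centroid if, in every configuration, its output $O$ satisfies $\mathrm{dist}(O,\mathrm{Cent}^\star)\le\alpha\cdot\mathrm{Rad_{cov}}$. *)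

theory Defs
  imports "HOL-Analysis.Analysis"
begin

text \<open>
  A received family \<open>(v\<^sub>i)\<^sub>i\<^sub>\<in>\<^sub>M\<close> is a partial map \<open>V\<close> from client indices to vectors with
  \<open>dom V = M\<close>, so that a function of \<open>V\<close> depends on exactly what the server receives.
  The dimension is \<open>d = CARD('d)\<close>, which is automatically at least 1.
\<close>

type_synonym 'd family = "nat \<rightharpoonup> real ^ 'd"

type_synonym 'd aggregation = "'d family \<Rightarrow> real ^ 'd"

definition received_family :: "nat \<Rightarrow> nat \<Rightarrow> ('d::finite) family \<Rightarrow> bool" where
  "received_family n t V \<longleftrightarrow> dom V \<subseteq> {1..n} \<and> n - t \<le> card (dom V)"

definition configuration :: "nat \<Rightarrow> nat \<Rightarrow> ('d::finite) family \<Rightarrow> nat set \<Rightarrow> bool" where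
  "configuration n t V N \<longleftrightarrow> received_family n t V \<and> N \<subseteq> dom V \<and> n - t \<le> card N"

definition vec_of :: "('d::finite) family \<Rightarrow> nat \<Rightarrow> real ^ 'd" where
  "vec_of V i = the (V i)"

definition average :: "('d::finite) family \<Rightarrow> nat set \<Rightarrow> real ^ 'd" where
  "average V I = (1 / real (card I)) *\<^sub>R (\<Sum>i\<in>I. vec_of V i)"

abbreviation true_centroid :: "('d::finite) family \<Rightarrow> nat set \<Rightarrow> real ^ 'd" where
  "true_centroid V N \<equiv> average V N"

definition candidate_subsets :: "nat \<Rightarrow> nat \<Rightarrow> ('d::finite) family \<Rightarrow> nat set set" where
  "candidate_subsets n t V = {I. I \<subseteq> dom V \<and> card I = n - t}"

definition S_Cent :: "nat \<Rightarrow> nat \<Rightarrow> ('d::finite) family \<Rightarrow> (real ^ 'd) set" where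
  "S_Cent n t V = average V ` candidate_subsets n t V"

text \<open>
  The infimum below is attained for nonempty bounded sets, see
  \<open>smallest_enclosing_radius_attained\<close>; it is then the radius of the smallest
  enclosing closed ball.
\<close>

definition smallest_enclosing_radius :: "'a::euclidean_space set \<Rightarrow> real" where
  "smallest_enclosing_radius S = Inf {r. \<exists>c. S \<subseteq> cball c r}"

definition Rad_cov :: "nat \<Rightarrow> nat \<Rightarrow> ('d::finite) family \<Rightarrow> real" where
  "Rad_cov n t V = smallest_enclosing_radius (S_Cent n t V)"

definition computes_centroid_approximation ::
    "nat \<Rightarrow> nat \<Rightarrow> real \<Rightarrow> ('d::finite) aggregation \<Rightarrow> bool" where
  "computes_centroid_approximation n t \<alpha> A \<longleftrightarrow>
     (\<forall>V N. configuration n t V N \<longrightarrow> dist (A V) (true_centroid V N) \<le> \<alpha> * Rad_cov n t V)"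

definition subset_diameter :: "('d::finite) family \<Rightarrow> nat set \<Rightarrow> real" where
  "subset_diameter V I = diameter (vec_of V ` I)"

definition smallest_diameter_subset ::
    "nat \<Rightarrow> nat \<Rightarrow> ('d::finite) family \<Rightarrow> nat set \<Rightarrow> bool" where
  "smallest_diameter_subset n t V I \<longleftrightarrow>
     I \<in> candidate_subsets n t V \<and>
     (\<forall>J\<in>candidate_subsets n t V. subset_diameter V I \<le> subset_diameter V J)"

text \<open>
  MDA leaves the choice between several subsets of smallest diameter open, so it is a property
  of aggregation algorithms: every tie-breaking rule yields an algorithm satisfying it.
\<close>

definition is_MDA :: "nat \<Rightarrow> nat \<Rightarrow> ('d::finite) aggregation \<Rightarrow> bool" where
  "is_MDA n t A \<longleftrightarrow>
     (\<forall>V. received_family n t V \<longrightarrow>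
        (\<exists>I. smallest_diameter_subset n t V I \<and> A V = average V I))"

lemma smallest_enclosing_radius_attained:
  fixes S :: "'a::euclidean_space set"
  assumes "S \<noteq> {}" "bounded S"
  shows "\<exists>c. S \<subseteq> cball c (smallest_enclosing_radius S)"
    and "S \<subseteq> cball c r \<Longrightarrow> smallest_enclosing_radius S \<le> r"
proof -
  let ?R = "{r. \<exists>c. S \<subseteq> cball c r}"
  obtain s where s: "s \<in> S" using assms(1) by blast
  have nonneg: "0 \<le> r" if "S \<subseteq> cball c r" for c r
  proof -
    have "dist c s \<le> r" using that s by (meson mem_cball subsetD)
    then show ?thesis using zero_le_dist[of c s] by linarith
  qed
  have "bdd_below ?R" by (rule bdd_belowI[of _ 0]) (use nonneg in blast)
  then show "smallest_enclosing_radius S \<le> r" if "S \<subseteq> cball c r"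
    unfolding smallest_enclosing_radius_def using that by (intro cInf_lower) blast+
  obtain c0 r0 where c0: "S \<subseteq> cball c0 r0"
    using bounded_subset_ballD[OF assms(2), of s] ball_subset_cball by blast
  define K where "K = {p. snd p \<le> r0} \<inter> (\<Inter>x\<in>S. {p. dist (fst p) x \<le> snd p})"
  have K: "(a, b) \<in> K \<longleftrightarrow> b \<le> r0 \<and> S \<subseteq> cball a b" for a b
    by (auto simp: K_def subset_iff)
  have "closed K" unfolding K_def
    by (intro closed_Int closed_INT ballI closed_Collect_le continuous_intros)
  moreover have "bounded K"
  proof (rule bounded_subset)
    show "bounded (cball s r0 \<times> {0..r0})" by (intro bounded_Times bounded_cball bounded_closed_interval)
    show "K \<subseteq> cball s r0 \<times> {0..r0}"
    proof
      fix p assume "p \<in> K"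
      then obtain a b where p: "p = (a, b)" and ab: "b \<le> r0" "S \<subseteq> cball a b"
        using K by (metis surj_pair)
      have "dist a s \<le> b" using ab(2) s by (meson mem_cball subsetD)
      then show "p \<in> cball s r0 \<times> {0..r0}"
        using p ab(1) nonneg[OF ab(2)] by (simp add: dist_commute)
    qed
  qed
  ultimately have "compact K" by (simp add: compact_eq_bounded_closed)
  moreover have "K \<noteq> {}" using c0 K by blast
  moreover have "continuous_on K snd" by (intro continuous_intros)
  ultimately obtain p where p: "p \<in> K" "\<forall>q\<in>K. snd p \<le> snd q"
    using continuous_attains_inf by metis
  obtain a b where ab: "p = (a, b)" by (metis surj_pair)
  have a: "b \<le> r0" "S \<subseteq> cball a b" using p(1) K ab by blast+
  have "b \<le> b'" if "S \<subseteq> cball a' b'" for a' b'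
  proof (cases "b' \<le> r0")
    case True
    then have "(a', b') \<in> K" using that K by blast
    then show ?thesis using p(2) ab by force
  next
    case False
    then show ?thesis using a(1) by linarith
  qed
  then have "Inf ?R = b"
    using a(2) by (intro cInf_eq_minimum) blast+
  then show "\<exists>c. S \<subseteq> cball c (smallest_enclosing_radius S)"
    using a(2) unfolding smallest_enclosing_radius_def by metis
qed

end

theory Submission
  imports Defs
begin

text \<open>
  The output is a candidate centroid, and the true centroid is a convex combination of candidate
  centroids: a mean over a finite set is the mean of the means over its subsets with one element
  removed, and this can be iterated down to cardinality \<open>n - t\<close>. Both points therefore lie in the
  smallest ball covering the candidate centroids, whose diameter is twice its radius.
\<close>

text \<open>Each vector is missing from exactly one of the sets \<open>N - {i}\<close>, so the sums
  over these sets add up to \<open>card N - 1\<close> times the full sum, which cancels the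
  denominator of the inner averages. At least two elements are required to keep that denominator
  nonzero.\<close>

lemma average_eq_sum_average_Diff:
  fixes V :: "('d::finite) family"
  assumes "finite N" and "card N \<ge> 2"
  shows "average V N = (\<Sum>i\<in>N. (1 / real (card N)) *\<^sub>R average V (N - {i}))"
proof -
  define S where "S = (\<Sum>i\<in>N. vec_of V i)"
  define m where "m = real (card N)"
  have m: "m \<ge> 2" using assms(2) by (simp add: m_def)
  have "average V (N - {i}) = (1 / (m - 1)) *\<^sub>R (S - vec_of V i)" if "i \<in> N" for i
    using that assms by (simp add: average_def S_def m_def sum_diff1 card_Diff_singleton of_nat_diff)
  then have "(\<Sum>i\<in>N. (1 / real (card N)) *\<^sub>R average V (N - {i}))
      = (\<Sum>i\<in>N. (1 / m * (1 / (m - 1))) *\<^sub>R (S - vec_of V i))"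
    by (intro sum.cong) (simp_all add: m_def)
  also have "\<dots> = (1 / m * (1 / (m - 1))) *\<^sub>R (\<Sum>i\<in>N. S - vec_of V i)"
    by (rule scaleR_sum_right [symmetric])
  also have "(\<Sum>i\<in>N. S - vec_of V i) = (m - 1) *\<^sub>R S"
    by (simp add: sum_subtractf S_def m_def scaleR_left_diff_distrib sum_constant_scaleR
        del: sum_constant)
  also have "(1 / m * (1 / (m - 1))) *\<^sub>R (m - 1) *\<^sub>R S = (1 / m) *\<^sub>R S"
    using m by simp
  finally show ?thesis by (simp add: average_def S_def m_def)
qed

lemma average_in_convex:
  fixes V :: "('d::finite) family"
  assumes "convex C" and "k \<ge> 1" and "finite N" and "k \<le> card N"
    and "\<And>I. I \<subseteq> N \<Longrightarrow> card I = k \<Longrightarrow> average V I \<in> C"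
  shows "average V N \<in> C"
  using assms(3-)
proof (induction "card N" arbitrary: N rule: less_induct)
  case less
  show ?case
  proof (cases "card N = k")
    case True
    then show ?thesis using less.prems(3) by blast
  next
    case False
    then have gt: "k < card N" using less.prems(2) by simp
    have "average V (N - {i}) \<in> C" if "i \<in> N" for i
    proof (rule less.hyps)
      show "card (N - {i}) < card N" "finite (N - {i})" "k \<le> card (N - {i})"
        using that gt less.prems(1) by (auto simp: card_Diff_singleton)
    qed (use less.prems(3) in blast)
    then have "(\<Sum>i\<in>N. (1 / real (card N)) *\<^sub>R average V (N - {i})) \<in> C"
      using gt less.prems(1) assms(1) by (intro convex_sum) auto
    \<comment> \<open>Here \<open>1 \<le> k < card N\<close> supplies the two elements that the
      averaging identity requires.\<close>
    then show ?thesis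
      using average_eq_sum_average_Diff[of N V] gt assms(2) less.prems(1) by simp
  qed
qed

theorem lemma3p6:
  fixes n t :: nat and MDA :: "('d::finite) aggregation"
  assumes "n \<ge> 1" and "n > 3 * t" and "is_MDA n t MDA"
  shows "computes_centroid_approximation n t 2 MDA"
  unfolding computes_centroid_approximation_def
proof (intro allI impI)
  fix V :: "'d family" and N
  assume conf: "configuration n t V N"
  then have rec: "received_family n t V" and N: "N \<subseteq> dom V" "n - t \<le> card N"
    by (auto simp: configuration_def)
  have fin: "finite (dom V)"
    using rec finite_subset by (auto simp: received_family_def)
  obtain I where "I \<in> candidate_subsets n t V" "MDA V = average V I"
    using assms(3) rec by (auto simp: is_MDA_def smallest_diameter_subset_def)
  then have out: "MDA V \<in> S_Cent n t V" by (simp add: S_Cent_def)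
  \<comment> \<open>Finiteness gives boundedness and \<open>out\<close> gives nonemptiness, so the
    infimum defining \<open>Rad_cov\<close> is attained: some covering ball has exactly this
    radius.\<close>
  have "finite (S_Cent n t V)"
    using fin by (simp add: S_Cent_def candidate_subsets_def)
  then obtain c where c: "S_Cent n t V \<subseteq> cball c (Rad_cov n t V)"
    using smallest_enclosing_radius_attained(1) out finite_imp_bounded
    unfolding Rad_cov_def by blast
  have "true_centroid V N \<in> cball c (Rad_cov n t V)"
  \<comment> \<open>The bound \<open>n > 3 * t\<close> makes \<open>n - t\<close> positive, and the
    convex set is the covering ball itself.\<close>
  proof (rule average_in_convex[where k = "n - t"])
    fix J assume "J \<subseteq> N" "card J = n - t"
    then have "average V J \<in> S_Cent n t V"
      using N(1) by (auto simp: S_Cent_def candidate_subsets_def)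
    then show "average V J \<in> cball c (Rad_cov n t V)" using c by blast
  qed (use assms(2) N fin finite_subset in auto)
  moreover have "MDA V \<in> cball c (Rad_cov n t V)" using out c by blast
  ultimately show "dist (MDA V) (true_centroid V N) \<le> 2 * Rad_cov n t V"
    using dist_triangle3[of "MDA V" "true_centroid V N" c] by simp
qed

end
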